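(* Let $A_1,\dots,A_n\in\mathbb{R}^d$, $A=[A_1,\dots,A_n]\in\mathbb{R}^{d\times n}$ and $\lambda>0$. Suppose each $\phi_i:\mathbb{R}\to\mathbb{R}$ is convex and $1/\gamma$-smooth ($\gamma>0$) and $g:\mathbb{R}^d\to\mathbb{R}$ is convex with convexity parameter $1$ (i.e. $1$-strongly convex with respect to the Euclidean norm). Let $f(x)=\lambda g^*\big(\frac{1}{\lambda n}Ax\big)$ and $\Psi(x)=\frac1n\sum_{i=1}^n\phi_i^*(-x_i)$ for $x\in\mathbb{R}^n$. Given any dual point $x^{(k)}\in\mathbb{R}^n$, define $$T(x^{(k)})=\arg\min_{x\in\mathbb{R}^n}\Big\{\langle\nabla f(x^{(k)}),x\rangle+\frac{\|A\|_2^2}{2\lambda n^2}\|x-x^{(k)}\|_2^2+\Psi(x)\Big\},\qquad w^{(k)}=\nabla g^*\Big(\frac{1}{\lambda n}A\,T(x^{(k)})\Big).$$ Then $$P(w^{(k)})-D(T(x^{(k)}))\ \le\ \frac{4\|A\|_2^2}{\lambda\gamma n}\,\big(D(x^\star)-D(x^{(k)})\big),$$ where $x^\star$ is the (unique) maximizer of $D$ over $\mathbb{R}^n$ and $\|A\|_2$ is the spectral norm of $A$.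
   Context: $\phi$ is $1/\gamma$-smooth if it is differentiable with $(1/\gamma)$-Lipschitz derivative. $\phi_i^*(u)=\sup_z\{zu-\phi_i(z)\}$ and $g^*$ denote convex conjugates. The primal and dual objectives of regularized empirical risk minimization are $$P(w)=\frac1n\sum_{i=1}^n\phi_i(A_i^Tw)+\lambda g(w)\ (w\in\mathbb{R}^d),\qquad D(x)=\frac1n\sum_{i=1}^n-\phi_i^*(-x_i)-\lambda g^*\Big(\frac{1}{\lambda n}Ax\Big)=-f(x)-\Psi(x)\in[-\infty,\infty)\ (x\in\mathbb{R}^n).$$ If $D(x^{(k)})=-\infty$ the inequality is vacuous (right-hand side read as $+\infty$). *)

theory Defs
  imports "HOL-Analysis.Analysis"
begin

definition smooth :: "real \<Rightarrow> (real \<Rightarrow> real) \<Rightarrow> bool" where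
  "smooth L h \<longleftrightarrow> (\<forall>x. h differentiable (at x)) \<and> L-lipschitz_on UNIV (deriv h)"

definition strongly_convex :: "real \<Rightarrow> ('a::real_inner \<Rightarrow> real) \<Rightarrow> bool" where
  "strongly_convex \<mu> h \<longleftrightarrow>
     (\<forall>x y t. 0 \<le> t \<longrightarrow> t \<le> 1 \<longrightarrow>
        h (t *\<^sub>R x + (1 - t) *\<^sub>R y)
          \<le> t * h x + (1 - t) * h y - \<mu> / 2 * t * (1 - t) * (norm (x - y))\<^sup>2)"

definition convex_conjugate :: "('a::real_inner \<Rightarrow> real) \<Rightarrow> 'a \<Rightarrow> ereal" where
  "convex_conjugate h u = (SUP z. ereal (u \<bullet> z - h z))"

text \<open>Gradient of an extended-real-valued function at a point near which it is finite;
  unspecified where no gradient exists.\<close>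

definition has_gradient :: "('a::real_inner \<Rightarrow> ereal) \<Rightarrow> 'a \<Rightarrow> 'a \<Rightarrow> bool" where
  "has_gradient F x v \<longleftrightarrow>
     (\<forall>\<^sub>F y in nhds x. \<bar>F y\<bar> \<noteq> \<infinity>) \<and> (GDERIV (\<lambda>y. real_of_ereal (F y)) x :> v)"

definition gradient :: "('a::real_inner \<Rightarrow> ereal) \<Rightarrow> 'a \<Rightarrow> 'a" where
  "gradient F x = (THE v. has_gradient F x v)"

text \<open>The spectral norm is the operator norm for the Euclidean norms; \<open>norm A\<close> on the matrix
  type would be the Frobenius norm.\<close>

definition spectral_norm :: "real^'n^'d \<Rightarrow> real" where
  "spectral_norm A = onorm ((*v) A)"

text \<open>The number of samples is \<open>CARD('n)\<close>, the data vectors are the columns of \<open>A\<close>.\<close>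

definition primal_obj :: "real^'n^'d \<Rightarrow> ('n \<Rightarrow> real \<Rightarrow> real) \<Rightarrow> (real^'d \<Rightarrow> real) \<Rightarrow> real
    \<Rightarrow> real^'d \<Rightarrow> real" where
  "primal_obj A \<phi> g lam w =
     1 / real CARD('n) * (\<Sum>i\<in>UNIV. \<phi> i (column i A \<bullet> w)) + lam * g w"

definition dual_obj :: "real^'n^'d \<Rightarrow> ('n \<Rightarrow> real \<Rightarrow> real) \<Rightarrow> (real^'d \<Rightarrow> real) \<Rightarrow> real
    \<Rightarrow> real^'n \<Rightarrow> ereal" where
  "dual_obj A \<phi> g lam x =
     ereal (1 / real CARD('n)) * (\<Sum>i\<in>UNIV. - convex_conjugate (\<phi> i) (- (x $ i)))
     - ereal lam * convex_conjugate g ((1 / (lam * real CARD('n))) *\<^sub>R (A *v x))"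

definition dual_f :: "real^'n^'d \<Rightarrow> (real^'d \<Rightarrow> real) \<Rightarrow> real \<Rightarrow> real^'n \<Rightarrow> ereal" where
  "dual_f A g lam x =
     ereal lam * convex_conjugate g ((1 / (lam * real CARD('n))) *\<^sub>R (A *v x))"

definition dual_Psi :: "('n \<Rightarrow> real \<Rightarrow> real) \<Rightarrow> real^'n \<Rightarrow> ereal" where
  "dual_Psi \<phi> x =
     ereal (1 / real CARD('n)) * (\<Sum>i\<in>UNIV. convex_conjugate (\<phi> i) (- (x $ i)))"

lemma convex_conjugate_neq_MInf: "convex_conjugate h u \<noteq> - \<infinity>"
proof -
  have "ereal (u \<bullet> 0 - h 0) \<le> convex_conjugate h u"
    unfolding convex_conjugate_def by (rule SUP_upper) simp
  then show ?thesis by auto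
qed

lemma dual_obj_eq: "dual_obj A \<phi> g lam x = - dual_f A g lam x - dual_Psi \<phi> x"
proof -
  define c where "c i = convex_conjugate (\<phi> i) (- (x $ i))" for i
  have c: "c i \<noteq> - \<infinity>" for i by (simp add: c_def convex_conjugate_neq_MInf)
  have "(\<Sum>i\<in>I. - c i) = - (\<Sum>i\<in>I. c i) \<and> (\<Sum>i\<in>I. c i) \<noteq> - \<infinity>" if "finite I" for I
    using that
  proof (induction I rule: finite_induct)
    case (insert i I)
    then show ?case
      using c[of i] by (cases "c i"; cases "\<Sum>i\<in>I. c i") auto
  qed simp
  then have "(\<Sum>i\<in>UNIV. - c i) = - (\<Sum>i\<in>UNIV. c i)" by simp
  then show ?thesis
    unfolding dual_obj_def dual_f_def dual_Psi_def c_def[symmetric]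
    by (simp add: minus_ereal_def add.commute)
qed

definition prox_model :: "real^'n^'d \<Rightarrow> ('n \<Rightarrow> real \<Rightarrow> real) \<Rightarrow> (real^'d \<Rightarrow> real) \<Rightarrow> real
    \<Rightarrow> real^'n \<Rightarrow> real^'n \<Rightarrow> ereal" where
  "prox_model A \<phi> g lam xk x =
     ereal (gradient (dual_f A g lam) xk \<bullet> x
       + (spectral_norm A)\<^sup>2 / (2 * lam * (real CARD('n))\<^sup>2) * (norm (x - xk))\<^sup>2)
     + dual_Psi \<phi> x"

definition prox_step :: "real^'n^'d \<Rightarrow> ('n \<Rightarrow> real \<Rightarrow> real) \<Rightarrow> (real^'d \<Rightarrow> real) \<Rightarrow> real
    \<Rightarrow> real^'n \<Rightarrow> real^'n" where
  "prox_step A \<phi> g lam xk = arg_min (prox_model A \<phi> g lam xk) (\<lambda>_. True)"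

definition primal_point :: "real^'n^'d \<Rightarrow> ('n \<Rightarrow> real \<Rightarrow> real) \<Rightarrow> (real^'d \<Rightarrow> real) \<Rightarrow> real
    \<Rightarrow> real^'n \<Rightarrow> real^'d" where
  "primal_point A \<phi> g lam xk =
     gradient (convex_conjugate g)
       ((1 / (lam * real CARD('n))) *\<^sub>R (A *v prox_step A \<phi> g lam xk))"

definition dual_opt :: "real^'n^'d \<Rightarrow> ('n \<Rightarrow> real \<Rightarrow> real) \<Rightarrow> (real^'d \<Rightarrow> real) \<Rightarrow> real
    \<Rightarrow> real^'n" where
  "dual_opt A \<phi> g lam = arg_max (dual_obj A \<phi> g lam) (\<lambda>_. True)"

end

theory Submission
  imports Defs
begin

text \<open>
  Smoothness of \<open>\<phi>\<close> gives, for every real \<open>s\<close>, a quadratic minorant of \<open>\<phi>\<^sup>*\<close> with slope \<open>s\<close> and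
  curvature \<open>\<gamma>\<close>, which touches \<open>\<phi>\<^sup>*\<close> at \<open>\<phi>' s\<close> when \<open>\<phi>\<close> is convex. So both optimizers can be
  written down explicitly, without lower semicontinuity or compactness in the dual: a minimizer
  \<open>w\<close> of \<open>P\<close> yields \<open>x\<^sup>\<star>\<^sub>i = - \<phi>\<^sub>i' (A\<^sub>i\<^sup>T w)\<close>, and the proximal step is \<open>T\<^sub>i = - \<phi>\<^sub>i' (s\<^sub>i)\<close>, where \<open>s\<close> solves
  \<open>s = n (\<nabla>f(x\<^sup>k) + M (T - x\<^sup>k))\<close> with \<open>M = \<parallel>A\<parallel>\<^sup>2 / (\<lambda> n\<^sup>2)\<close>, coordinatewise by the intermediate value
  theorem.

  The duality gap at \<open>T\<close> is the mean of the Bregman distances of \<open>\<phi>\<^sub>i\<close> between \<open>(n \<nabla>f(T))\<^sub>i\<close> and \<open>s\<^sub>i\<close>,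
  hence at most \<open>n / (2\<gamma>) \<parallel>\<nabla>f(T) - \<nabla>f(x\<^sup>k) - M (T - x\<^sup>k)\<parallel>\<^sup>2 \<le> 2 n M\<^sup>2 / \<gamma> \<parallel>T - x\<^sup>k\<parallel>\<^sup>2\<close>, as \<open>\<nabla>f\<close> is
  \<open>M\<close>-Lipschitz. The step increases \<open>D\<close> by at least \<open>M / 2 \<parallel>T - x\<^sup>k\<parallel>\<^sup>2\<close>.
\<close>

section \<open>Smooth convex functions of one variable and their conjugates\<close>

text \<open>The gap \<open>\<psi>\<close> between the quadratic model and \<open>h\<close> is
  smallest at \<open>s\<close>: the Lipschitz bound makes its derivative nonnegative to the right of
  \<open>s\<close> and nonpositive to the left.\<close>

lemma smooth_descent:
  assumes "smooth L h"
  shows "h z \<le> h s + deriv h s * (z - s) + L / 2 * (z - s)\<^sup>2"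
proof -
  have D: "(h has_real_derivative deriv h x) (at x)" for x
    using assms by (auto simp: smooth_def DERIV_deriv_iff_real_differentiable)
  have lip: "\<bar>deriv h x - deriv h s\<bar> \<le> L * \<bar>x - s\<bar>" for x
    using assms unfolding smooth_def lipschitz_on_def by (auto simp: dist_real_def)
  define \<psi> where "\<psi> x = h s + deriv h s * (x - s) + L / 2 * (x - s)\<^sup>2 - h x" for x
  have D\<psi>: "(\<psi> has_real_derivative (deriv h s + L * (x - s) - deriv h x)) (at x)" for x
    unfolding \<psi>_def by (auto intro!: derivative_eq_intros D)
  have "\<psi> s \<le> \<psi> z"
  proof (cases "s \<le> z")
    case True
    show ?thesis
    proof (rule DERIV_nonneg_imp_nondecreasing[OF True])
      fix x assume "s \<le> x" "x \<le> z"
      then show "\<exists>y. (\<psi> has_real_derivative y) (at x) \<and> 0 \<le> y"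
        using D\<psi>[of x] lip[of x] by (intro exI[of _ "deriv h s + L * (x - s) - deriv h x"]) auto
    qed
  next
    case False
    show ?thesis
    proof (rule DERIV_nonpos_imp_nonincreasing[of z s \<psi>])
      show "z \<le> s" using False by simp
      fix x assume "z \<le> x" "x \<le> s"
      then have "deriv h s + L * (x - s) - deriv h x \<le> 0"
        using lip[of x] by (auto simp: abs_if algebra_simps split: if_splits)
      with D\<psi>[of x] show "\<exists>y. (\<psi> has_real_derivative y) (at x) \<and> y \<le> 0"
        by blast
    qed
  qed
  then show ?thesis by (simp add: \<psi>_def)
qed

lemma convex_above_tangent:
  assumes "convex_on UNIV h" "smooth L h"
  shows "h s + deriv h s * (z - s) \<le> h z"
proof -
  have "(h has_real_derivative deriv h s) (at s)"
    using assms by (auto simp: smooth_def DERIV_deriv_iff_real_differentiable)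
  then have "h z - h s \<ge> deriv h s * (z - s)"
    using assms(1) by (intro convex_on_imp_above_tangent[where A = UNIV]) auto
  then show ?thesis by simp
qed

text \<open>Equality case of the Fenchel-Young inequality: if \<open>u\<close> is a subgradient at
  \<open>s\<close>, the supremum is attained at \<open>s\<close>.\<close>

lemma convex_conjugate_eqI:
  assumes "\<And>z. h s + u \<bullet> (z - s) \<le> h z"
  shows "convex_conjugate h u = ereal (u \<bullet> s - h s)"
  unfolding convex_conjugate_def
proof (rule antisym)
  show "(SUP z. ereal (u \<bullet> z - h z)) \<le> ereal (u \<bullet> s - h s)"
    using assms by (intro SUP_least) (simp add: inner_diff_right, smt (verit))
qed (rule SUP_upper, simp)

text \<open>Conjugation reverses the order, and the left side is the conjugate at \<open>u\<close>
  of the quadratic majorant of \<open>h\<close> around \<open>s\<close>.\<close>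

lemma convex_conjugate_smooth_lower:
  assumes "smooth (1 / \<gamma>) h" "\<gamma> > 0"
  shows "ereal (s * u - h s + \<gamma> / 2 * (u - deriv h s)\<^sup>2) \<le> convex_conjugate h u"
proof -
  \<comment> \<open>This point maximizes \<open>u * z\<close> minus the quadratic majorant.\<close>
  define z where "z = s + \<gamma> * (u - deriv h s)"
  have "(1 / \<gamma>) / 2 * (z - s)\<^sup>2 = \<gamma> / 2 * (u - deriv h s)\<^sup>2"
    using assms(2) by (simp add: z_def power2_eq_square)
  moreover have "u * z - deriv h s * (z - s) = s * u + \<gamma> * (u - deriv h s)\<^sup>2"
    by (simp add: z_def algebra_simps power2_eq_square)
  moreover have "\<gamma> * (u - deriv h s)\<^sup>2 = \<gamma> / 2 * (u - deriv h s)\<^sup>2 + \<gamma> / 2 * (u - deriv h s)\<^sup>2"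
    by simp
  ultimately have "s * u - h s + \<gamma> / 2 * (u - deriv h s)\<^sup>2 \<le> u * z - h z"
    using smooth_descent[OF assms(1), of z s] by linarith
  also have "ereal (u * z - h z) \<le> convex_conjugate h u"
    unfolding convex_conjugate_def by (rule SUP_upper2[of z]) auto
  finally show ?thesis by simp
qed

text \<open>\<open>deriv h\<close> is continuous and, by the tangent inequalities, nondecreasing, so
  the intermediate value theorem applies. This solves the optimality condition of the proximal step
  in a single coordinate.\<close>

lemma resolvent_deriv_exists:
  assumes "convex_on UNIV h" "smooth L h" "K \<ge> 0"
  shows "\<exists>s. s + K * deriv h s = r"
proof -
  have mono: "deriv h x \<le> deriv h y" if "x \<le> y" for x y
  proof (cases "x = y")
    case False
    have "deriv h x * (y - x) \<le> deriv h y * (y - x)"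
      using convex_above_tangent[OF assms(1,2), of x y] convex_above_tangent[OF assms(1,2), of y x]
      by (simp add: algebra_simps)
    then show ?thesis using that False by (simp add: mult_le_cancel_right)
  qed simp
  have cont: "isCont (deriv h) x" for x
    using assms(2) lipschitz_on_continuous_on[of L UNIV "deriv h"]
    by (simp add: smooth_def continuous_on_eq_continuous_at)
  \<comment> \<open>As \<open>a \<le> 0 \<le> b\<close>, monotonicity replaces
    \<open>deriv h\<close> at both ends by its value at \<open>0\<close>, so the two end values
    enclose \<open>r\<close>.\<close>
  define a where "a = min 0 (r - K * deriv h 0)"
  define b where "b = max 0 (r - K * deriv h 0)"
  have "K * deriv h a \<le> K * deriv h 0" "K * deriv h 0 \<le> K * deriv h b"
    using assms(3) by (auto intro!: mult_left_mono mono simp: a_def b_def)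
  then have "\<exists>s\<ge>a. s \<le> b \<and> s + K * deriv h s = r"
    by (intro IVT) (auto simp: a_def b_def intro!: continuous_intros cont)
  then show ?thesis by blast
qed

section \<open>Strongly convex functions: minimizers and quadratic growth\<close>

lemma strongly_convex_imp_convex_on:
  assumes "strongly_convex \<mu> h" "\<mu> \<ge> 0"
  shows "convex_on UNIV h"
proof (rule convex_onI)
  fix t :: real and x y
  assume "0 < t" "t < 1"
  then have "h ((1 - t) *\<^sub>R x + (1 - (1 - t)) *\<^sub>R y)
      \<le> (1 - t) * h x + (1 - (1 - t)) * h y - \<mu> / 2 * (1 - t) * (1 - (1 - t)) * (norm (x - y))\<^sup>2"
    using assms(1) unfolding strongly_convex_def
    by (elim allE[of _ x] allE[of _ y] allE[of _ "1 - t"]) auto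
  moreover have "0 \<le> \<mu> / 2 * (1 - t) * (1 - (1 - t)) * (norm (x - y))\<^sup>2"
    using \<open>0 < t\<close> \<open>t < 1\<close> assms(2) by simp
  ultimately show "h ((1 - t) *\<^sub>R x + t *\<^sub>R y) \<le> (1 - t) * h x + t * h y"
    by simp
qed simp

lemma strongly_convex_add_convex:
  assumes "strongly_convex \<mu> h" "convex_on UNIV k"
  shows "strongly_convex \<mu> (\<lambda>x. h x + k x)"
  unfolding strongly_convex_def
proof (intro allI impI)
  fix x y and t :: real
  assume t: "0 \<le> t" "t \<le> 1"
  have "k (t *\<^sub>R x + (1 - t) *\<^sub>R y) \<le> t * k x + (1 - t) * k y"
    using assms(2) t by (auto simp: convex_on_def)
  moreover have "h (t *\<^sub>R x + (1 - t) *\<^sub>R y)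
      \<le> t * h x + (1 - t) * h y - \<mu> / 2 * t * (1 - t) * (norm (x - y))\<^sup>2"
    using assms(1) t unfolding strongly_convex_def by blast
  ultimately show "h (t *\<^sub>R x + (1 - t) *\<^sub>R y) + k (t *\<^sub>R x + (1 - t) *\<^sub>R y)
      \<le> t * (h x + k x) + (1 - t) * (h y + k y) - \<mu> / 2 * t * (1 - t) * (norm (x - y))\<^sup>2"
    by (simp add: algebra_simps)
qed

lemma convex_on_sum_fun:
  assumes "finite I" "convex S" "\<And>i. i \<in> I \<Longrightarrow> convex_on S (f i)"
  shows "convex_on S (\<lambda>x. \<Sum>i\<in>I. f i x)"
  using assms(1,3)
proof (induction I rule: finite_induct)
  case empty
  then show ?case using assms(2) by (simp add: convex_on_def)
next
  case (insert i I)
  then show ?case by (simp add: convex_on_add)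
qed

text \<open>Strong convexity on the segment from \<open>0\<close> to a distant point keeps
  \<open>h\<close> there at or above \<open>h 0\<close>, so a minimizer over a large ball, which
  exists by continuity, is global.\<close>

lemma strongly_convex_attains_min:
  fixes h :: "'a::euclidean_space \<Rightarrow> real"
  assumes sc: "strongly_convex \<mu> h" and \<mu>: "\<mu> > 0"
  shows "\<exists>w. \<forall>z. h w \<le> h z"
proof -
  have cont: "continuous_on S h" for S
    using convex_on_continuous[OF open_UNIV strongly_convex_imp_convex_on[OF sc]] \<mu>
    by (auto intro: continuous_on_subset)
  obtain p where p: "p \<in> cball 0 1" "\<And>x. x \<in> cball 0 1 \<Longrightarrow> h p \<le> h x"
    using continuous_attains_inf[of "cball 0 1" h] cont by auto
  \<comment> \<open>If \<open>h x < h 0\<close> and \<open>r = norm x > 1\<close>, the unit vector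
    along \<open>x\<close> has value at least \<open>h p\<close>, and strong convexity yields
    \<open>\<mu> / 2 * (r - 1) \<le> h 0 - h p\<close>; this is solved for \<open>r\<close>.\<close>
  define R where "R = 1 + 2 * (h 0 - h p) / \<mu>"
  have R: "R \<ge> 1" using p(2)[of 0] \<mu> by (simp add: R_def)
  have far: "h 0 \<le> h x" if "norm x > R" for x
  proof (rule ccontr)
    assume neg: "\<not> h 0 \<le> h x"
    define r where "r = norm x"
    have r: "r > 1" "r > R" using that R by (auto simp: r_def)
    have "h p \<le> h ((1 / r) *\<^sub>R x)" using r by (intro p) (simp add: r_def)
    also have "h ((1 / r) *\<^sub>R x) = h ((1 / r) *\<^sub>R x + (1 - 1 / r) *\<^sub>R 0)" by simp
    also have "\<dots> \<le> (1 / r) * h x + (1 - 1 / r) * h 0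
        - \<mu> / 2 * (1 / r) * (1 - 1 / r) * (norm (x - 0))\<^sup>2"
      using r by (intro sc[unfolded strongly_convex_def, rule_format]) auto
    also have "\<mu> / 2 * (1 / r) * (1 - 1 / r) * (norm (x - 0))\<^sup>2 = \<mu> / 2 * (r - 1)"
      using r by (simp add: r_def[symmetric] power2_eq_square field_simps)
    also have "(1 / r) * h x + (1 - 1 / r) * h 0 \<le> h 0"
      using neg r by (simp add: field_simps)
    finally have "r \<le> R" using \<mu> by (simp add: R_def field_simps)
    with r show False by simp
  qed
  obtain q where q: "\<And>x. x \<in> cball 0 R \<Longrightarrow> h q \<le> h x"
    using continuous_attains_inf[of "cball 0 R" h] cont R
    by (metis cball_eq_empty compact_cball less_le_not_le order_trans zero_less_one not_le)
  have "h q \<le> h z" for z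
  proof (cases "norm z \<le> R")
    case True
    then show ?thesis using q by simp
  next
    case False
    then show ?thesis using far[of z] q[of 0] R by simp
  qed
  then show ?thesis by blast
qed

text \<open>The upper model lets \<open>v\<close> act as the gradient of \<open>k\<close> at
  \<open>w\<close>, so optimality makes \<open>- v\<close> a subgradient of \<open>g\<close>. A
  linear \<open>k\<close> gives the maximizers behind the conjugate of \<open>g\<close>; the loss
  term as \<open>k\<close> gives the dual maximizer.\<close>

lemma strongly_convex_subgradient_growth:
  fixes g k :: "'a::real_inner \<Rightarrow> real"
  assumes sc: "strongly_convex \<mu> g"
    and min: "\<And>z. g w + k w \<le> g z + k z"
    and k: "\<And>z. k z \<le> k w + v \<bullet> (z - w) + K * (norm (z - w))\<^sup>2"
  shows "g w - v \<bullet> (z - w) + \<mu> / 2 * (norm (z - w))\<^sup>2 \<le> g z"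
proof -
  define N where "N = (norm (z - w))\<^sup>2"
  define a where "a = g z - g w - \<mu> / 2 * N + v \<bullet> (z - w)"
  define b where "b = \<mu> / 2 * N + K * N"
  \<comment> \<open>Multiplied by \<open>t\<close>, this is an upper bound for the increase of
    \<open>g + k\<close> from \<open>w\<close> to the point \<open>x\<close> on the segment; letting
    \<open>t\<close> tend to \<open>0\<close> leaves \<open>a\<close>.\<close>
  have "0 \<le> a + t * b" if t: "0 < t" "t < 1" for t
  proof -
    define x where "x = t *\<^sub>R z + (1 - t) *\<^sub>R w"
    have xw: "x - w = t *\<^sub>R (z - w)" by (simp add: x_def algebra_simps)
    have "g x \<le> t * g z + (1 - t) * g w - \<mu> / 2 * t * (1 - t) * N"
      using sc t unfolding strongly_convex_def x_def N_def by simp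
    moreover have "k x \<le> k w + t * (v \<bullet> (z - w)) + K * (t\<^sup>2 * N)"
      using k[of x] by (simp add: xw N_def power_mult_distrib)
    moreover have "t * (a + t * b) = t * g z + (1 - t) * g w - \<mu> / 2 * t * (1 - t) * N - g w
        + (t * (v \<bullet> (z - w)) + K * (t\<^sup>2 * N))"
      by (simp add: a_def b_def field_simps power2_eq_square)
    ultimately have "0 \<le> t * (a + t * b)"
      using min[of x] by linarith
    then show ?thesis using t by (simp add: zero_le_mult_iff)
  qed
  then have "\<forall>\<^sub>F t in at_right 0. 0 \<le> a + t * b"
    unfolding eventually_at_right_field by (intro exI[of _ 1]) auto
  moreover have "((\<lambda>t. a + t * b) \<longlongrightarrow> a + 0 * b) (at_right 0)"
    by (intro tendsto_intros)
  ultimately have "0 \<le> a + 0 * b"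
    by (intro tendsto_lowerbound) auto
  then show ?thesis by (simp add: a_def N_def)
qed

section \<open>Gradients of conjugates\<close>

text \<open>The quadratic error bound gives Frechet differentiability, and uniqueness of the
  derivative resolves the definite description in \<open>gradient\<close>.\<close>

lemma gradient_eqI:
  fixes h :: "'a::real_inner \<Rightarrow> real"
  assumes F: "\<And>y. F y = ereal (h y)"
    and quad: "\<And>y. \<bar>h y - h x - v \<bullet> (y - x)\<bar> \<le> K * (norm (y - x))\<^sup>2"
  shows "gradient F x = v"
proof -
  have "((\<lambda>y. norm (h y - h x - (y - x) \<bullet> v) / norm (y - x)) \<longlongrightarrow> 0) (at x)"
  proof (rule Lim_null_comparison)
    show "\<forall>\<^sub>F y in at x. norm (norm (h y - h x - (y - x) \<bullet> v) / norm (y - x)) \<le> K * norm (y - x)"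
    proof (rule eventuallyI)
      fix y
      show "norm (norm (h y - h x - (y - x) \<bullet> v) / norm (y - x)) \<le> K * norm (y - x)"
        using quad[of y]
        by (cases "y = x") (auto simp: divide_simps inner_commute power2_eq_square mult.assoc)
    qed
    have "((\<lambda>y. K * norm (y - x)) \<longlongrightarrow> K * norm (x - x)) (at x)"
      by (intro tendsto_intros)
    then show "((\<lambda>y. K * norm (y - x)) \<longlongrightarrow> 0) (at x)" by simp
  qed
  then have "(h has_derivative (\<lambda>d. d \<bullet> v)) (at x)"
    by (simp add: has_derivative_iff_norm bounded_linear_inner_left)
  then have v: "has_gradient F x v"
    by (simp add: has_gradient_def F gderiv_def)
  have "u = v" if "has_gradient F x u" for u
  proof -
    have "(h has_derivative (\<lambda>d. d \<bullet> u)) (at x)"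
      using that by (simp add: has_gradient_def F gderiv_def)
    then have "(\<lambda>d. d \<bullet> u) = (\<lambda>d. d \<bullet> v)"
      using \<open>(h has_derivative (\<lambda>d. d \<bullet> v)) (at x)\<close> has_derivative_unique by blast
    then have "(u - v) \<bullet> u = (u - v) \<bullet> v" by (rule fun_cong)
    then show ?thesis by (metis cancel_comm_monoid_add_class.diff_cancel eq_iff_diff_eq_0 inner_diff_right inner_eq_zero_iff)
  qed
  with v show ?thesis unfolding gradient_def by blast
qed

text \<open>The supremum in the conjugate at \<open>u\<close> is attained at some
  \<open>V u\<close>, with quadratic growth. This point is the gradient, since the conjugate differs
  from its linearization with slope \<open>V u\<close> by a quadratic error.\<close>

lemma strongly_convex_gradient_conjugate:
  fixes g :: "'a::euclidean_space \<Rightarrow> real"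
  assumes sc: "strongly_convex \<mu> g" and \<mu>: "\<mu> > 0"
  defines "W \<equiv> gradient (convex_conjugate g)"
  shows "g (W u) + u \<bullet> (z - W u) + \<mu> / 2 * (norm (z - W u))\<^sup>2 \<le> g z"
proof -
  have "\<exists>w. \<forall>z. g w + u \<bullet> (z - w) + \<mu> / 2 * (norm (z - w))\<^sup>2 \<le> g z" for u
  proof -
    have "convex_on UNIV (\<lambda>x. - u \<bullet> x)"
      by (auto simp: convex_on_def inner_add_right)
    then obtain w where w: "\<And>z. g w + - u \<bullet> w \<le> g z + - u \<bullet> z"
      using strongly_convex_attains_min[OF strongly_convex_add_convex[OF sc] \<mu>] by blast
    have "g w - - u \<bullet> (z - w) + \<mu> / 2 * (norm (z - w))\<^sup>2 \<le> g z" for z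
      by (rule strongly_convex_subgradient_growth[OF sc w, where K = 0]) (simp add: inner_diff_right)
    then show ?thesis by auto
  qed
  then obtain V where V: "\<And>u z. g (V u) + u \<bullet> (z - V u) + \<mu> / 2 * (norm (z - V u))\<^sup>2 \<le> g z"
    by metis
  define G where "G u = u \<bullet> V u - g (V u)" for u
  have "g (V u) + u \<bullet> (z - V u) \<le> g z" for u z
    using V[of u z] \<mu> by (smt (verit) divide_nonneg_nonneg mult_nonneg_nonneg zero_le_power2)
  then have conj: "convex_conjugate g u = ereal (G u)" for u
    unfolding G_def by (rule convex_conjugate_eqI)
  have "W u = V u" for u
    unfolding W_def
  proof (rule gradient_eqI[OF conj])
    fix y
    define d where "d = V y - V u"
    have 1: "u \<bullet> V y - g (V y) + \<mu> / 2 * (norm d)\<^sup>2 \<le> G u"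
      using V[of u "V y"] by (simp add: G_def d_def inner_diff_right)
    have 2: "y \<bullet> V u - g (V u) + \<mu> / 2 * (norm d)\<^sup>2 \<le> G y"
      using V[of y "V u"] by (simp add: G_def d_def inner_diff_right norm_minus_commute)
    \<comment> \<open>Young's inequality, from expanding the square of
      \<open>norm (\<mu> *\<^sub>R d - e)\<close>.\<close>
    have "e \<bullet> d \<le> \<mu> / 2 * (norm d)\<^sup>2 + 1 / (2 * \<mu>) * (norm e)\<^sup>2" for e
    proof -
      have "(norm (\<mu> *\<^sub>R d - e))\<^sup>2 = \<mu>\<^sup>2 * (norm d)\<^sup>2 + (norm e)\<^sup>2 - 2 * \<mu> * (e \<bullet> d)"
        unfolding power2_norm_eq_inner
        by (simp add: inner_diff_left inner_diff_right inner_commute power2_eq_square)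
      then have "(norm (\<mu> *\<^sub>R d - e))\<^sup>2 / (2 * \<mu>)
          = \<mu> / 2 * (norm d)\<^sup>2 + 1 / (2 * \<mu>) * (norm e)\<^sup>2 - e \<bullet> d"
        using \<mu> by (simp add: field_simps power2_eq_square)
      moreover have "0 \<le> (norm (\<mu> *\<^sub>R d - e))\<^sup>2 / (2 * \<mu>)" using \<mu> by simp
      ultimately show ?thesis by simp
    qed
    then have 3: "(y - u) \<bullet> d \<le> \<mu> / 2 * (norm d)\<^sup>2 + 1 / (2 * \<mu>) * (norm (y - u))\<^sup>2" .
    have 4: "0 \<le> \<mu> / 2 * (norm d)\<^sup>2" "0 \<le> 1 / (2 * \<mu>) * (norm (y - u))\<^sup>2"
      using \<mu> by simp_all
    have 5: "G y = u \<bullet> V y - g (V y) + V u \<bullet> (y - u) + (y - u) \<bullet> d"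
      by (simp add: G_def d_def inner_diff_left inner_diff_right inner_commute)
    have 6: "y \<bullet> V u - g (V u) = G u + V u \<bullet> (y - u)"
      by (simp add: G_def inner_diff_left inner_diff_right inner_commute)
    \<comment> \<open>The lower estimate is 2 with 6. For the upper one, 5 is combined with 1 and 3,
      where the two terms quadratic in \<open>d\<close> cancel.\<close>
    show "\<bar>G y - G u - V u \<bullet> (y - u)\<bar> \<le> 1 / (2 * \<mu>) * (norm (y - u))\<^sup>2"
      unfolding abs_le_iff
      using 1 2 3 4 5 6 by linarith
  qed
  then show ?thesis using V by simp
qed

section \<open>Spectral norm of a matrix and its transpose\<close>

lemma norm_matrix_vector_le_spectral_norm: "norm (A *v x) \<le> spectral_norm A * norm x"
  unfolding spectral_norm_def by (rule onorm) simp

lemma spectral_norm_nonneg: "0 \<le> spectral_norm A"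
  unfolding spectral_norm_def by (rule onorm_pos_le) simp

text \<open>Here \<open>w v* A\<close> is the transpose of \<open>A\<close> applied to
  \<open>w\<close>. Its squared norm is an inner product of \<open>w\<close> with a vector in the
  range of \<open>A\<close>, which Cauchy-Schwarz bounds.\<close>

lemma norm_vector_matrix_le_spectral_norm: "norm (w v* A) \<le> spectral_norm A * norm w"
proof (cases "w v* A = 0")
  case False
  have "norm (w v* A) * norm (w v* A) = w \<bullet> (A *v (w v* A))"
    by (simp add: dot_lmul_matrix[symmetric] dot_square_norm power2_eq_square)
  also have "\<dots> \<le> norm w * norm (A *v (w v* A))" by (rule norm_cauchy_schwarz)
  also have "\<dots> \<le> norm w * (spectral_norm A * norm (w v* A))"
    by (intro mult_left_mono norm_matrix_vector_le_spectral_norm) simp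
  finally show ?thesis using False by (simp add: mult.commute)
qed (simp add: spectral_norm_nonneg)

lemma column_inner_eq: "column i A \<bullet> w = (w v* A) $ i"
  by (simp add: column_def inner_vec_def vector_matrix_mult_def mult.commute)

section \<open>Strict minimizers and the separable dual term\<close>

lemma unique_arg_min:
  assumes "F x0 = ereal p" "\<kappa> > 0" "\<And>x. ereal (p + \<kappa> * (norm (x - x0))\<^sup>2) \<le> F x"
  shows "is_arg_min F (\<lambda>_. True) x \<longleftrightarrow> x = x0"
proof -
  have less: "F x0 < F x" if "x \<noteq> x0" for x
    using assms(3)[of x] that assms(1,2) by (intro less_le_trans[OF _ assms(3)]) simp
  then have "F x0 \<le> F x" for x by (cases "x = x0") (auto intro: less_imp_le)
  with less show ?thesis unfolding is_arg_min_def by (metis not_less)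
qed

text \<open>Convexity makes each derivative a subgradient, so the Fenchel-Young equality holds in
  every coordinate.\<close>

lemma dual_Psi_at:
  fixes \<phi> :: "'n::finite \<Rightarrow> real \<Rightarrow> real"
  assumes "\<And>i. convex_on UNIV (\<phi> i)" "\<And>i. smooth L (\<phi> i)"
  shows "dual_Psi \<phi> (\<chi> i. - deriv (\<phi> i) (s $ i)) =
    ereal (1 / real CARD('n) * (\<Sum>i\<in>UNIV. s $ i * deriv (\<phi> i) (s $ i) - \<phi> i (s $ i)))"
proof -
  have "convex_conjugate (\<phi> i) (deriv (\<phi> i) (s $ i))
      = ereal (s $ i * deriv (\<phi> i) (s $ i) - \<phi> i (s $ i))" for i
    using convex_conjugate_eqI[of "\<phi> i" "s $ i" "deriv (\<phi> i) (s $ i)"]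
      convex_above_tangent[OF assms(1,2)[of i]] by (simp add: mult.commute)
  then show ?thesis by (simp add: dual_Psi_def)
qed

text \<open>Sum of the scalar minorants at \<open>u = - (x $ i)\<close>; this sign turns the slope
  into \<open>- s / n\<close>. By \<open>dual_Psi_at\<close> the bound is tight at \<open>x0\<close>
  for convex \<open>\<phi> i\<close>.\<close>

lemma dual_Psi_lower:
  fixes \<phi> :: "'n::finite \<Rightarrow> real \<Rightarrow> real"
  assumes "\<And>i. smooth (1 / \<gamma>) (\<phi> i)" "\<gamma> > 0"
    and x0: "x0 = (\<chi> i. - deriv (\<phi> i) (s $ i))"
  shows "ereal (1 / real CARD('n) * (\<Sum>i\<in>UNIV. s $ i * deriv (\<phi> i) (s $ i) - \<phi> i (s $ i))
      - 1 / real CARD('n) * (s \<bullet> (x - x0)) + \<gamma> / (2 * real CARD('n)) * (norm (x - x0))\<^sup>2)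
    \<le> dual_Psi \<phi> x"
proof -
  let ?n = "real CARD('n)"
  let ?u = "\<lambda>i. deriv (\<phi> i) (s $ i)"
  have "(norm (x - x0))\<^sup>2 = (\<Sum>i\<in>UNIV. (x $ i + ?u i)\<^sup>2)"
    unfolding power2_norm_eq_inner by (simp add: inner_vec_def x0 power2_eq_square)
  moreover have "s \<bullet> (x - x0) = (\<Sum>i\<in>UNIV. s $ i * (x $ i + ?u i))"
    by (simp add: inner_vec_def x0)
  moreover have "(\<Sum>i\<in>UNIV. s $ i * ?u i - \<phi> i (s $ i)) - (\<Sum>i\<in>UNIV. s $ i * (x $ i + ?u i))
        + \<gamma> / 2 * (\<Sum>i\<in>UNIV. (x $ i + ?u i)\<^sup>2)
      = (\<Sum>i\<in>UNIV. s $ i * - (x $ i) - \<phi> i (s $ i) + \<gamma> / 2 * (- (x $ i) - ?u i)\<^sup>2)"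
    (is "_ = ?S")
    unfolding sum_distrib_left sum_subtractf[symmetric] sum.distrib[symmetric]
    by (intro sum.cong refl) (simp add: algebra_simps power2_eq_square)
  ultimately have "1 / ?n * (\<Sum>i\<in>UNIV. s $ i * ?u i - \<phi> i (s $ i))
      - 1 / ?n * (s \<bullet> (x - x0)) + \<gamma> / (2 * ?n) * (norm (x - x0))\<^sup>2 = 1 / ?n * ?S"
    (is "?lhs = _")
    by (simp add: field_simps)
  then have "ereal ?lhs = ereal (1 / ?n) *
      (\<Sum>i\<in>UNIV. ereal (s $ i * - (x $ i) - \<phi> i (s $ i) + \<gamma> / 2 * (- (x $ i) - ?u i)\<^sup>2))"
    by simp
  also have "\<dots> \<le> dual_Psi \<phi> x"
    unfolding dual_Psi_def
    by (intro ereal_mult_left_mono sum_mono convex_conjugate_smooth_lower assms(1,2)) simp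
  finally show ?thesis .
qed

section \<open>The smooth dual term\<close>

text \<open>\<open>W x\<close> attains the supremum in the conjugate of \<open>g\<close>, which
  gives the real formula \<open>F\<close>. The constant \<open>M\<close> arises because the gradient
  map of the conjugate is 1-Lipschitz and is composed with \<open>A\<close> on one side and its
  transpose on the other.\<close>

lemma dual_f_smooth:
  fixes A :: "real^'n^'d" and g :: "real^'d \<Rightarrow> real"
  assumes "lam > 0" "strongly_convex 1 g"
  defines "n \<equiv> real CARD('n)"
  defines "M \<equiv> (spectral_norm A)\<^sup>2 / (lam * n\<^sup>2)"
  defines "W \<equiv> \<lambda>x. gradient (convex_conjugate g) ((1 / (lam * n)) *\<^sub>R (A *v x))"
  defines "F \<equiv> \<lambda>x. 1 / n * ((W x v* A) \<bullet> x) - lam * g (W x)"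
  defines "F' \<equiv> \<lambda>x. (1 / n) *\<^sub>R (W x v* A)"
  shows "dual_f A g lam x = ereal (F x)"
    and "F x + F' x \<bullet> (y - x) \<le> F y"
    and "F y \<le> F x + F' x \<bullet> (y - x) + M / 2 * (norm (y - x))\<^sup>2"
    and "gradient (dual_f A g lam) x = F' x"
    and "norm (F' y - F' x) \<le> M * norm (y - x)"
proof -
  have n: "n > 0" by (simp add: n_def)
  define u where "u x = (1 / (lam * n)) *\<^sub>R (A *v x)" for x
  define U where "U x = gradient (convex_conjugate g) (u x)" for x
  have W: "W = U" by (simp add: W_def U_def u_def fun_eq_iff)
  have U: "g (U x) + u x \<bullet> (z - U x) + 1 / 2 * (norm (z - U x))\<^sup>2 \<le> g z" for x z
    unfolding U_def by (rule strongly_convex_gradient_conjugate) (use assms in auto)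
  have uU: "lam * (u y \<bullet> w) = 1 / n * ((w v* A) \<bullet> y)" for y w
    using assms(1) by (simp add: u_def dot_lmul_matrix inner_commute[of "A *v y" w])
  have F: "F x = lam * (u x \<bullet> U x - g (U x))" for x
    using uU[of x "U x"] by (simp add: F_def W algebra_simps)
  have conj: "convex_conjugate g (u x) = ereal (u x \<bullet> U x - g (U x))" for x
  proof (rule convex_conjugate_eqI)
    fix z show "g (U x) + u x \<bullet> (z - U x) \<le> g z"
      using U[of x z] zero_le_power2[of "norm (z - U x)"] by linarith
  qed
  show f: "dual_f A g lam x = ereal (F x)" for x
    using conj[of x] by (simp add: dual_f_def F u_def n_def)
  have F': "F' x \<bullet> (y - x) = lam * (u y \<bullet> U x) - lam * (u x \<bullet> U x)" for x y
    by (simp add: uU F'_def W inner_diff_right algebra_simps)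
  show lower: "F x + F' x \<bullet> (y - x) \<le> F y" for x y
  proof -
    \<comment> \<open>\<open>U x\<close> is only one candidate in the supremum whose maximizer is
      \<open>U y\<close>.\<close>
    have "u y \<bullet> U x - g (U x) \<le> u y \<bullet> U y - g (U y)"
      using U[of y "U x"] zero_le_power2[of "norm (U x - U y)"]
      unfolding inner_diff_right by linarith
    then have "lam * (u y \<bullet> U x - g (U x)) \<le> lam * (u y \<bullet> U y - g (U y))"
      using assms(1) by (intro mult_left_mono) auto
    then show ?thesis
      unfolding F' F right_diff_distrib by linarith
  qed
  have M: "lam * (norm (u y - u x))\<^sup>2 \<le> M * (norm (y - x))\<^sup>2" for x y
  proof -
    have "norm (u y - u x) = 1 / (lam * n) * norm (A *v (y - x))"
      using assms(1) n
      by (simp add: u_def scaleR_diff_right[symmetric] matrix_vector_mult_diff_distrib)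
    then have "lam * (norm (u y - u x))\<^sup>2 = 1 / (lam * n\<^sup>2) * (norm (A *v (y - x)))\<^sup>2"
      using assms(1) n by (simp add: power_mult_distrib power_divide power2_eq_square)
    also have "\<dots> \<le> 1 / (lam * n\<^sup>2) * (spectral_norm A * norm (y - x))\<^sup>2"
      using assms(1) by (intro mult_left_mono power_mono norm_matrix_vector_le_spectral_norm) auto
    finally show ?thesis by (simp add: M_def power_mult_distrib)
  qed
  show upper: "F y \<le> F x + F' x \<bullet> (y - x) + M / 2 * (norm (y - x))\<^sup>2" for x y
  proof -
    \<comment> \<open>The growth of \<open>g\<close> around \<open>U x\<close> supplies
      \<open>- 1 / 2 * (norm d)\<^sup>2\<close>, exactly what Young's inequality costs when
      \<open>e \<bullet> d\<close> is split.\<close>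
    define d e where "d = U y - U x" and "e = u y - u x"
    have "0 \<le> (norm (e - d))\<^sup>2" by simp
    also have "(norm (e - d))\<^sup>2 = (norm e)\<^sup>2 + (norm d)\<^sup>2 - 2 * (e \<bullet> d)"
      unfolding power2_norm_eq_inner
      by (simp add: inner_diff_left inner_diff_right inner_commute)
    finally have ed: "e \<bullet> d \<le> 1 / 2 * (norm e)\<^sup>2 + 1 / 2 * (norm d)\<^sup>2" by simp
    have "u y \<bullet> U y - g (U y) = u x \<bullet> U y - g (U y) + u y \<bullet> U x - u x \<bullet> U x + e \<bullet> d"
      by (simp add: d_def e_def inner_diff_left inner_diff_right)
    moreover have "u x \<bullet> U y - g (U y) \<le> u x \<bullet> U x - g (U x) - 1 / 2 * (norm d)\<^sup>2"
      using U[of x "U y"] by (simp add: d_def inner_diff_right)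
    ultimately have "u y \<bullet> U y - g (U y)
        \<le> (u x \<bullet> U x - g (U x)) + (u y \<bullet> U x - u x \<bullet> U x) + 1 / 2 * (norm e)\<^sup>2"
      using ed by linarith
    then have "lam * (u y \<bullet> U y - g (U y))
        \<le> lam * ((u x \<bullet> U x - g (U x)) + (u y \<bullet> U x - u x \<bullet> U x) + 1 / 2 * (norm e)\<^sup>2)"
      using assms(1) by (intro mult_left_mono) auto
    also have "\<dots> = F x + F' x \<bullet> (y - x) + 1 / 2 * (lam * (norm e)\<^sup>2)"
      by (simp only: F F' distrib_left right_diff_distrib mult.left_commute)
    finally have "F y \<le> F x + F' x \<bullet> (y - x) + 1 / 2 * (lam * (norm e)\<^sup>2)"
      by (simp only: F)
    with M[of y x] show ?thesis by (simp add: e_def)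
  qed
  show "gradient (dual_f A g lam) x = F' x"
  proof (rule gradient_eqI[OF f])
    fix y show "\<bar>F y - F x - F' x \<bullet> (y - x)\<bar> \<le> M / 2 * (norm (y - x))\<^sup>2"
      using lower[of x y] upper[of y x] by linarith
  qed
  have U_lip: "norm (U y - U x) \<le> norm (u y - u x)"
  proof (cases "U y = U x")
    case False
    \<comment> \<open>Adding the two growth inequalities gives strong monotonicity of the
      maximizers.\<close>
    have "norm (U y - U x) * norm (U y - U x) \<le> (u y - u x) \<bullet> (U y - U x)"
      using U[of x "U y"] U[of y "U x"]
      by (simp add: inner_diff_left inner_diff_right norm_minus_commute power2_eq_square)
    also have "\<dots> \<le> norm (u y - u x) * norm (U y - U x)" by (rule norm_cauchy_schwarz)
    finally show ?thesis using False by simp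
  qed simp
  have "norm (F' y - F' x) = 1 / n * norm ((U y - U x) v* A)"
    using n by (simp add: F'_def W scaleR_diff_right[symmetric] vector_matrix_mult_diff_distrib)
  also have "\<dots> \<le> 1 / n * (spectral_norm A * norm (u y - u x))"
    using n U_lip
    by (intro mult_left_mono order_trans[OF norm_vector_matrix_le_spectral_norm] spectral_norm_nonneg) auto
  also have "norm (u y - u x) = 1 / (lam * n) * norm (A *v (y - x))"
    using assms(1) n
    by (simp add: u_def scaleR_diff_right[symmetric] matrix_vector_mult_diff_distrib)
  also have "1 / n * (spectral_norm A * (1 / (lam * n) * norm (A *v (y - x))))
      \<le> 1 / n * (spectral_norm A * (1 / (lam * n) * (spectral_norm A * norm (y - x))))"
    using n assms(1)
    by (intro mult_left_mono norm_matrix_vector_le_spectral_norm spectral_norm_nonneg) auto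
  also have "\<dots> = M * norm (y - x)" by (simp add: M_def power2_eq_square mult_ac)
  finally show "norm (F' y - F' x) \<le> M * norm (y - x)" .
qed

section \<open>Existence and uniqueness of the dual maximizer\<close>

lemma ereal_le_add_trans:
  assumes "ereal q \<le> P" "p \<le> c + q"
  shows "ereal p \<le> ereal c + P"
  using assms by (cases P) auto

text \<open>Built from a primal minimizer \<open>w\<close>, the point \<open>x0\<close> satisfies
  the optimality conditions of both dual terms, so their linear lower bounds cancel. The curvature
  \<gamma>/n of the separable term then makes it the only maximizer.\<close>

lemma dual_obj_unique_max:
  fixes A :: "real^'n^'d" and \<phi> :: "'n \<Rightarrow> real \<Rightarrow> real" and g :: "real^'d \<Rightarrow> real"
  assumes "lam > 0" "\<gamma> > 0"
    and cvx: "\<And>i. convex_on UNIV (\<phi> i)" and sm: "\<And>i. smooth (1 / \<gamma>) (\<phi> i)"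
    and sc: "strongly_convex 1 g"
  shows "\<exists>!x. is_arg_max (dual_obj A \<phi> g lam) (\<lambda>_. True) x"
proof -
  define n where "n = real CARD('n)"
  have n: "n > 0" by (simp add: n_def)
  \<comment> \<open>With this scaling \<open>g + k\<close> is the primal objective divided by
    \<open>lam\<close>.\<close>
  define k where "k w = 1 / (lam * n) * (\<Sum>i\<in>UNIV. \<phi> i ((w v* A) $ i))" for w
  have "convex_on UNIV (\<lambda>w. \<phi> i ((w v* A) $ i))" for i
  proof (rule convex_onI)
    fix t :: real and x y assume "0 < t" "t < 1"
    then have "\<phi> i ((1 - t) * (x v* A) $ i + t * (y v* A) $ i)
        \<le> (1 - t) * \<phi> i ((x v* A) $ i) + t * \<phi> i ((y v* A) $ i)"
      using convex_onD[OF cvx[of i], of t] by simp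
    moreover have "(((1 - t) *\<^sub>R x + t *\<^sub>R y) v* A) $ i = (1 - t) * (x v* A) $ i + t * (y v* A) $ i"
      by (simp add: column_inner_eq[symmetric] inner_add_right)
    ultimately show "\<phi> i ((((1 - t) *\<^sub>R x + t *\<^sub>R y) v* A) $ i)
        \<le> (1 - t) * \<phi> i ((x v* A) $ i) + t * \<phi> i ((y v* A) $ i)"
      by simp
  qed simp
  then have "convex_on UNIV k"
    unfolding k_def[abs_def] using assms(1) n
    by (intro convex_on_cmul convex_on_sum_fun) auto
  then obtain w where w: "\<And>z. g w + k w \<le> g z + k z"
    using strongly_convex_attains_min[OF strongly_convex_add_convex[OF sc]] by force
  define s where "s = w v* A"
  define x0 where "x0 = (\<chi> i. - deriv (\<phi> i) (s $ i))"
  define u where "u x = (1 / (lam * n)) *\<^sub>R (A *v x)" for x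
  have k_upper: "k z \<le> k w + (- u x0) \<bullet> (z - w) + (spectral_norm A)\<^sup>2 / (2 * lam * n * \<gamma>) * (norm (z - w))\<^sup>2" for z
  proof -
    define d where "d = (z - w) v* A"
    have "(\<Sum>i\<in>UNIV. \<phi> i ((z v* A) $ i))
        \<le> (\<Sum>i\<in>UNIV. \<phi> i (s $ i) + (- x0 $ i) * d $ i + 1 / \<gamma> / 2 * (d $ i)\<^sup>2)"
      using smooth_descent[OF sm]
      by (intro sum_mono) (simp add: x0_def d_def s_def vector_matrix_mult_diff_distrib)
    also have "\<dots> = (\<Sum>i\<in>UNIV. \<phi> i (s $ i)) - d \<bullet> x0 + 1 / (2 * \<gamma>) * (norm d)\<^sup>2"
      unfolding power2_norm_eq_inner
      by (simp add: inner_vec_def sum.distrib sum_subtractf sum_negf sum_distrib_left power2_eq_square mult.commute)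
    also have "\<dots> \<le> (\<Sum>i\<in>UNIV. \<phi> i (s $ i)) - d \<bullet> x0 + 1 / (2 * \<gamma>) * (spectral_norm A * norm (z - w))\<^sup>2"
      unfolding d_def using assms(2)
      by (intro add_left_mono mult_left_mono power_mono norm_vector_matrix_le_spectral_norm) auto
    finally have "k z \<le> 1 / (lam * n) * ((\<Sum>i\<in>UNIV. \<phi> i (s $ i)) - d \<bullet> x0
        + 1 / (2 * \<gamma>) * (spectral_norm A * norm (z - w))\<^sup>2)"
      unfolding k_def using assms(1) n by (intro mult_left_mono) auto
    also have "d \<bullet> x0 = (A *v x0) \<bullet> (z - w)" by (simp add: d_def dot_lmul_matrix inner_commute[of "A *v x0"])
    also have "1 / (lam * n) * ((\<Sum>i\<in>UNIV. \<phi> i (s $ i)) - (A *v x0) \<bullet> (z - w)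
        + 1 / (2 * \<gamma>) * (spectral_norm A * norm (z - w))\<^sup>2)
      = k w + (- u x0) \<bullet> (z - w) + (spectral_norm A)\<^sup>2 / (2 * lam * n * \<gamma>) * (norm (z - w))\<^sup>2"
      using assms(1,2) n
      by (simp add: k_def s_def u_def power_mult_distrib inner_diff_right field_simps)
    finally show ?thesis .
  qed
  \<comment> \<open>First-order optimality at \<open>w\<close>: \<open>u x0\<close> is a subgradient
    of \<open>g\<close> there, so the conjugate of \<open>g\<close> at \<open>u x0\<close> is
    attained at \<open>w\<close>.\<close>
  have sub: "g w + u x0 \<bullet> (z - w) \<le> g z" for z
    using strongly_convex_subgradient_growth[OF sc w k_upper, of z] zero_le_power2[of "norm (z - w)"]
    unfolding inner_minus_left by linarith
  define p where "p = 1 / n * (\<Sum>i\<in>UNIV. s $ i * deriv (\<phi> i) (s $ i) - \<phi> i (s $ i))"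
  define c where "c x = lam * (u x \<bullet> w - g w)" for x
  have uw: "lam * (u x \<bullet> w) = 1 / n * (s \<bullet> x)" for x
    using assms(1) by (simp add: u_def s_def dot_lmul_matrix inner_commute[of "A *v x" w])
  have f0: "dual_f A g lam x0 = ereal (c x0)"
    using convex_conjugate_eqI[of g, OF sub] by (simp add: dual_f_def u_def c_def n_def)
  have f: "ereal (c x) \<le> dual_f A g lam x" for x
  proof -
    have "ereal (u x \<bullet> w - g w) \<le> convex_conjugate g (u x)"
      unfolding convex_conjugate_def by (rule SUP_upper) simp
    from ereal_mult_left_mono[OF this, of "ereal lam"] show ?thesis
      using assms(1) by (simp add: dual_f_def u_def c_def n_def)
  qed
  let ?H = "\<lambda>x. dual_f A g lam x + dual_Psi \<phi> x"
  have Psi0: "dual_Psi \<phi> x0 = ereal p"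
    unfolding x0_def p_def n_def by (rule dual_Psi_at[OF cvx sm])
  have H: "ereal (c x0 + p + \<gamma> / (2 * n) * (norm (x - x0))\<^sup>2) \<le> ?H x" for x
  proof -
    have "ereal (c x0 + p + \<gamma> / (2 * n) * (norm (x - x0))\<^sup>2) \<le> ereal (c x) + dual_Psi \<phi> x"
    proof (rule ereal_le_add_trans[OF dual_Psi_lower[OF sm assms(2) x0_def, of x]])
      have "c x - c x0 = 1 / n * (s \<bullet> (x - x0))"
        using uw by (simp add: c_def right_diff_distrib inner_diff_right)
      then show "c x0 + p + \<gamma> / (2 * n) * (norm (x - x0))\<^sup>2 \<le> c x + (1 / real CARD('n) *
          (\<Sum>i\<in>UNIV. s $ i * deriv (\<phi> i) (s $ i) - \<phi> i (s $ i)) - 1 / real CARD('n) * (s \<bullet> (x - x0))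
          + \<gamma> / (2 * real CARD('n)) * (norm (x - x0))\<^sup>2)"
        unfolding p_def n_def by linarith
    qed
    also have "\<dots> \<le> ?H x" by (intro add_right_mono f)
    finally show ?thesis .
  qed
  \<comment> \<open>Neither term is \<open>- \<infinity>\<close>, so negation distributes over the
    sum of extended reals.\<close>
  have D: "dual_obj A \<phi> g lam x = - ?H x" for x
  proof -
    have "dual_f A g lam x \<noteq> - \<infinity>" "dual_Psi \<phi> x \<noteq> - \<infinity>"
      using f[of x] dual_Psi_lower[OF sm assms(2) x0_def, of x] by auto
    then show ?thesis
      unfolding dual_obj_eq by (cases "dual_f A g lam x"; cases "dual_Psi \<phi> x") simp_all
  qed
  have "is_arg_min ?H (\<lambda>_. True) x \<longleftrightarrow> x = x0" for x
    by (rule unique_arg_min[OF _ _ H]) (use assms(2) n f0 Psi0 in auto)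
  moreover have "is_arg_max (dual_obj A \<phi> g lam) (\<lambda>_. True) x \<longleftrightarrow> is_arg_min ?H (\<lambda>_. True) x" for x
    unfolding is_arg_max_def is_arg_min_def D ereal_minus_less_minus by simp
  ultimately show ?thesis by simp
qed

section \<open>The proximal step\<close>

text \<open>At the minimizer the gradient \<open>s / n\<close> of the linear and quadratic part
  balances the subgradient \<open>- s / n\<close> of \<open>dual_Psi\<close>. The resulting equation
  for \<open>s\<close> separates by coordinates.\<close>

lemma prox_step_characterization:
  fixes A :: "real^'n^'d" and \<phi> :: "'n \<Rightarrow> real \<Rightarrow> real" and g :: "real^'d \<Rightarrow> real"
    and xk :: "real^'n"
  assumes "lam > 0" "\<gamma> > 0"
    and cvx: "\<And>i. convex_on UNIV (\<phi> i)" and sm: "\<And>i. smooth (1 / \<gamma>) (\<phi> i)"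
  defines "n \<equiv> real CARD('n)"
  defines "M \<equiv> (spectral_norm A)\<^sup>2 / (lam * n\<^sup>2)"
  defines "v \<equiv> gradient (dual_f A g lam) xk"
  defines "T \<equiv> prox_step A \<phi> g lam xk"
  shows "is_arg_min (prox_model A \<phi> g lam xk) (\<lambda>_. True) x \<longleftrightarrow> x = T"
    and "T = (\<chi> i. - deriv (\<phi> i) ((n *\<^sub>R (v + M *\<^sub>R (T - xk))) $ i))"
proof -
  have n: "n > 0" by (simp add: n_def)
  have M: "M \<ge> 0" using assms(1) by (simp add: M_def)
  \<comment> \<open>Obtained from \<open>s = n *\<^sub>R (v + M *\<^sub>R (x0 - xk))\<close> by
    substituting \<open>- deriv (\<phi> i) s\<close> for the coordinate of
    \<open>x0\<close>.\<close>
  have "\<exists>s. s + n * M * deriv (\<phi> i) s = n * (v $ i - M * xk $ i)" for i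
    using n M by (intro resolvent_deriv_exists[OF cvx sm]) simp
  then obtain S where S: "\<And>i. S i + n * M * deriv (\<phi> i) (S i) = n * (v $ i - M * xk $ i)"
    by metis
  define s where "s = (\<chi> i. S i)"
  define x0 where "x0 = (\<chi> i. - deriv (\<phi> i) (s $ i))"
  have s: "s = n *\<^sub>R (v + M *\<^sub>R (x0 - xk))"
  proof -
    have "s $ i = n * (v $ i + M * (x0 $ i - xk $ i))" for i
      using S[of i] by (simp add: s_def x0_def algebra_simps)
    then show ?thesis by (simp add: vec_eq_iff)
  qed
  define p where "p = 1 / n * (\<Sum>i\<in>UNIV. s $ i * deriv (\<phi> i) (s $ i) - \<phi> i (s $ i))"
  define c where "c x = v \<bullet> x + M / 2 * (norm (x - xk))\<^sup>2" for x
  have model: "prox_model A \<phi> g lam xk x = ereal (c x) + dual_Psi \<phi> x" for x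
    by (simp add: prox_model_def c_def v_def M_def n_def field_simps)
  have Psi0: "dual_Psi \<phi> x0 = ereal p"
    unfolding x0_def p_def n_def by (rule dual_Psi_at[OF cvx sm])
  have H: "ereal (c x0 + p + \<gamma> / (2 * n) * (norm (x - x0))\<^sup>2) \<le> prox_model A \<phi> g lam xk x" for x
    unfolding model
  proof (rule ereal_le_add_trans[OF dual_Psi_lower[OF sm assms(2) x0_def, of x]])
    have sq: "(norm (x - xk))\<^sup>2 = (norm (x0 - xk))\<^sup>2 + 2 * ((x0 - xk) \<bullet> (x - x0)) + (norm (x - x0))\<^sup>2"
      unfolding power2_norm_eq_inner
      by (simp add: inner_diff_left inner_diff_right inner_commute)
    have "1 / n * (s \<bullet> (x - x0)) = v \<bullet> (x - x0) + M * ((x0 - xk) \<bullet> (x - x0))"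
      using n by (simp add: s inner_add_left)
    moreover have "c x - c x0 = v \<bullet> (x - x0) + M * ((x0 - xk) \<bullet> (x - x0)) + M / 2 * (norm (x - x0))\<^sup>2"
      unfolding c_def sq by (simp add: inner_diff_right field_simps)
    moreover have "0 \<le> M / 2 * (norm (x - x0))\<^sup>2" using M by simp
    \<comment> \<open>\<open>s / n\<close> is the gradient of the convex function \<open>c\<close>
      at \<open>x0\<close>; it cancels the slope of the minorant of \<open>dual_Psi\<close>.\<close>
    ultimately have "1 / n * (s \<bullet> (x - x0)) \<le> c x - c x0" by linarith
    then show "c x0 + p + \<gamma> / (2 * n) * (norm (x - x0))\<^sup>2 \<le> c x + (1 / real CARD('n) *
          (\<Sum>i\<in>UNIV. s $ i * deriv (\<phi> i) (s $ i) - \<phi> i (s $ i)) - 1 / real CARD('n) * (s \<bullet> (x - x0))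
          + \<gamma> / (2 * real CARD('n)) * (norm (x - x0))\<^sup>2)"
      unfolding p_def n_def by linarith
  qed
  have iff: "is_arg_min (prox_model A \<phi> g lam xk) (\<lambda>_. True) x \<longleftrightarrow> x = x0" for x
    by (rule unique_arg_min[OF _ _ H]) (use assms(2) n Psi0 in \<open>auto simp: model\<close>)
  have T: "T = x0"
    unfolding T_def prox_step_def arg_min_def iff by simp
  show "is_arg_min (prox_model A \<phi> g lam xk) (\<lambda>_. True) x \<longleftrightarrow> x = T"
    by (simp add: iff T)
  show "T = (\<chi> i. - deriv (\<phi> i) ((n *\<^sub>R (v + M *\<^sub>R (T - xk))) $ i))"
    unfolding T s[symmetric] by (rule x0_def)
qed

section \<open>The duality gap bound\<close>

text \<open>The two uniqueness clauses ensure that the choices in \<open>dual_opt\<close> and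
  \<open>prox_step\<close> denote the intended points. The premise on \<open>xk\<close> encodes that
  the inequality is vacuous when the dual value is \<open>- \<infinity>\<close>.\<close>

theorem theorem4:
  fixes A :: "real^'n^'d"
    and \<phi> :: "'n \<Rightarrow> real \<Rightarrow> real"
    and g :: "real^'d \<Rightarrow> real"
    and lam \<gamma> :: real
    and xk :: "real^'n"
  assumes "lam > 0" and "\<gamma> > 0"
    and "\<And>i. convex_on UNIV (\<phi> i)"
    and "\<And>i. smooth (1 / \<gamma>) (\<phi> i)"
    and "strongly_convex 1 g"
  shows "(\<exists>!x. is_arg_max (dual_obj A \<phi> g lam) (\<lambda>_. True) x) \<and>
    (\<exists>!x. is_arg_min (prox_model A \<phi> g lam xk) (\<lambda>_. True) x) \<and>
    (dual_obj A \<phi> g lam xk \<noteq> - \<infinity> \<longrightarrow>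
      ereal (primal_obj A \<phi> g lam (primal_point A \<phi> g lam xk))
          - dual_obj A \<phi> g lam (prox_step A \<phi> g lam xk)
        \<le> ereal (4 * (spectral_norm A)\<^sup>2 / (lam * \<gamma> * real CARD('n)))
            * (dual_obj A \<phi> g lam (dual_opt A \<phi> g lam) - dual_obj A \<phi> g lam xk))"
proof (intro conjI impI)
  show max: "\<exists>!x. is_arg_max (dual_obj A \<phi> g lam) (\<lambda>_. True) x"
    by (rule dual_obj_unique_max[OF assms])
  show "\<exists>!x. is_arg_min (prox_model A \<phi> g lam xk) (\<lambda>_. True) x"
    unfolding prox_step_characterization(1)[OF assms(1-4)] by simp
  assume fin: "dual_obj A \<phi> g lam xk \<noteq> - \<infinity>"
  define n where "n = real CARD('n)"
  have n: "n > 0" by (simp add: n_def)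
  define M where "M = (spectral_norm A)\<^sup>2 / (lam * n\<^sup>2)"
  have M: "M \<ge> 0" using assms(1) by (simp add: M_def)
  define T where "T = prox_step A \<phi> g lam xk"
  define W where "W x = gradient (convex_conjugate g) ((1 / (lam * n)) *\<^sub>R (A *v x))" for x
  define F where "F x = 1 / n * ((W x v* A) \<bullet> x) - lam * g (W x)" for x
  define F' where "F' x = (1 / n) *\<^sub>R (W x v* A)" for x
  note f = dual_f_smooth[OF assms(1,5), where A = A, folded n_def, folded M_def W_def,
      folded F_def F'_def]
  define s where "s = n *\<^sub>R (F' xk + M *\<^sub>R (T - xk))"
  define z where "z = W T v* A"
  have T: "T = (\<chi> i. - deriv (\<phi> i) (s $ i))"
    using prox_step_characterization(2)[where \<phi> = \<phi> and A = A and g = g and xk = xk, OF assms(1-4)]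
    unfolding n_def[symmetric] M_def[symmetric] T_def[symmetric] f(4) s_def[symmetric] .
  define p where "p = 1 / n * (\<Sum>i\<in>UNIV. s $ i * deriv (\<phi> i) (s $ i) - \<phi> i (s $ i))"
  have PsiT: "dual_Psi \<phi> T = ereal p"
    by (subst T) (unfold p_def n_def, rule dual_Psi_at[OF assms(3,4)])
  have DT: "dual_obj A \<phi> g lam T = ereal (- F T - p)"
    by (simp add: dual_obj_eq f(1) PsiT)
  obtain q where q: "dual_Psi \<phi> xk = ereal q"
  proof (cases "dual_Psi \<phi> xk")
    case PInf
    then show ?thesis using fin by (simp add: dual_obj_eq f(1))
  next
    case MInf
    then show ?thesis using dual_Psi_lower[OF assms(4,2) T, of xk] by simp
  qed
  have Dk: "dual_obj A \<phi> g lam xk = ereal (- F xk - q)"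
    by (simp add: dual_obj_eq f(1) q)
  define N where "N = (norm (T - xk))\<^sup>2"
  \<comment> \<open>The minorant of \<open>dual_Psi\<close> at \<open>T\<close>, evaluated at
    \<open>xk\<close>, gains \<open>M * N\<close>; the quadratic upper model of \<open>F\<close>
    gives back half of it.\<close>
  have descent: "F T + p + M / 2 * N \<le> F xk + q"
  proof -
    have "p - 1 / n * (s \<bullet> (xk - T)) + \<gamma> / (2 * n) * (norm (xk - T))\<^sup>2 \<le> q"
      using dual_Psi_lower[OF assms(4,2) T, of xk] unfolding q p_def n_def by simp
    moreover have "0 \<le> \<gamma> / (2 * n) * (norm (xk - T))\<^sup>2" using assms(2) n by simp
    moreover have "1 / n * (s \<bullet> (xk - T)) = - (F' xk \<bullet> (T - xk)) - M * N"
    proof -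
      have "1 / n * (s \<bullet> (xk - T)) = - (1 / n * (s \<bullet> (T - xk)))"
        by (simp add: inner_diff_right right_diff_distrib)
      also have "1 / n * (s \<bullet> (T - xk)) = F' xk \<bullet> (T - xk) + M * N"
        using n by (simp add: s_def N_def inner_add_left power2_norm_eq_inner)
      finally show ?thesis by simp
    qed
    ultimately show ?thesis using f(3)[of T xk] unfolding N_def by simp
  qed
  have gap: "primal_obj A \<phi> g lam (W T) + F T + p \<le> n / (2 * \<gamma>) * (norm (F' T - F' xk - M *\<^sub>R (T - xk)))\<^sup>2"
  proof -
    \<comment> \<open>\<open>lam * g (W T)\<close> cancels against the same term in
      \<open>F T\<close>; the rest is regrouped by coordinates into Bregman distances.\<close>
    have "primal_obj A \<phi> g lam (W T) + F T + p
        = 1 / n * ((\<Sum>i\<in>UNIV. \<phi> i (z $ i)) + z \<bullet> T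
          + (\<Sum>i\<in>UNIV. s $ i * deriv (\<phi> i) (s $ i) - \<phi> i (s $ i)))"
      by (simp add: primal_obj_def column_inner_eq F_def p_def n_def[symmetric] z_def distrib_left)
    also have "z \<bullet> T = (\<Sum>i\<in>UNIV. - (z $ i) * deriv (\<phi> i) (s $ i))"
      by (subst T) (simp add: inner_vec_def)
    also have "(\<Sum>i\<in>UNIV. \<phi> i (z $ i)) + \<dots> + (\<Sum>i\<in>UNIV. s $ i * deriv (\<phi> i) (s $ i) - \<phi> i (s $ i))
        = (\<Sum>i\<in>UNIV. \<phi> i (z $ i) - \<phi> i (s $ i) - deriv (\<phi> i) (s $ i) * (z $ i - s $ i))"
      unfolding sum.distrib[symmetric] by (intro sum.cong refl) (simp add: algebra_simps)
    also have "1 / n * \<dots> \<le> 1 / n * (\<Sum>i\<in>UNIV. 1 / \<gamma> / 2 * (z $ i - s $ i)\<^sup>2)"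
    proof (intro mult_left_mono sum_mono)
      fix i
      show "\<phi> i (z $ i) - \<phi> i (s $ i) - deriv (\<phi> i) (s $ i) * (z $ i - s $ i)
          \<le> 1 / \<gamma> / 2 * (z $ i - s $ i)\<^sup>2"
        using smooth_descent[OF assms(4), of i "z $ i" "s $ i"] by linarith
    qed (use n in simp)
    also have "\<dots> = 1 / (2 * n * \<gamma>) * (norm (z - s))\<^sup>2"
      unfolding power2_norm_eq_inner
      by (simp add: inner_vec_def sum_divide_distrib[symmetric] power2_eq_square mult.commute)
    also have "z - s = n *\<^sub>R (F' T - F' xk - M *\<^sub>R (T - xk))"
      using n by (simp add: z_def s_def F'_def algebra_simps)
    finally show ?thesis using n by (simp add: power_mult_distrib power2_eq_square mult_ac)
  qed
  \<comment> \<open>One \<open>M\<close> is the Lipschitz constant of \<open>F'\<close>, the other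
    the weight of the proximal term; squaring their sum produces the factor 4.\<close>
  have "norm (F' T - F' xk - M *\<^sub>R (T - xk)) \<le> M * norm (T - xk) + M * norm (T - xk)"
    using norm_triangle_ineq4[of "F' T - F' xk" "M *\<^sub>R (T - xk)"] f(5)[of T xk] M by simp
  then have "(norm (F' T - F' xk - M *\<^sub>R (T - xk)))\<^sup>2 \<le> (2 * M * norm (T - xk))\<^sup>2"
    by (intro power_mono) auto
  from mult_left_mono[OF this, of "n / (2 * \<gamma>)"] gap
  have "primal_obj A \<phi> g lam (W T) - (- F T - p) \<le> n / (2 * \<gamma>) * (2 * M * norm (T - xk))\<^sup>2"
    using n assms(2) by simp
  also have "\<dots> = (4 * n * M / \<gamma>) * (M / 2 * N)"
    by (simp add: N_def power_mult_distrib power2_eq_square)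
  also have "\<dots> \<le> (4 * n * M / \<gamma>) * ((- F T - p) - (- F xk - q))"
    using descent n M assms(2) by (intro mult_left_mono) auto
  also have "4 * n * M / \<gamma> = 4 * (spectral_norm A)\<^sup>2 / (lam * \<gamma> * n)"
    using n by (simp add: M_def power2_eq_square)
  finally have "ereal (primal_obj A \<phi> g lam (W T)) - dual_obj A \<phi> g lam T
      \<le> ereal (4 * (spectral_norm A)\<^sup>2 / (lam * \<gamma> * n))
        * (dual_obj A \<phi> g lam T - dual_obj A \<phi> g lam xk)"
    by (simp add: DT Dk)
  also have "\<dots> \<le> ereal (4 * (spectral_norm A)\<^sup>2 / (lam * \<gamma> * n))
        * (dual_obj A \<phi> g lam (dual_opt A \<phi> g lam) - dual_obj A \<phi> g lam xk)"
  proof (intro ereal_mult_left_mono ereal_minus_mono order_refl)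
    have "is_arg_max (dual_obj A \<phi> g lam) (\<lambda>_. True) (dual_opt A \<phi> g lam)"
      unfolding dual_opt_def arg_max_def using max by (blast intro: someI_ex)
    then show "dual_obj A \<phi> g lam T \<le> dual_obj A \<phi> g lam (dual_opt A \<phi> g lam)"
      by (simp add: is_arg_max_def not_less)
  qed (use n assms(1,2) in simp)
  finally show "ereal (primal_obj A \<phi> g lam (primal_point A \<phi> g lam xk))
          - dual_obj A \<phi> g lam (prox_step A \<phi> g lam xk)
        \<le> ereal (4 * (spectral_norm A)\<^sup>2 / (lam * \<gamma> * real CARD('n)))
            * (dual_obj A \<phi> g lam (dual_opt A \<phi> g lam) - dual_obj A \<phi> g lam xk)"
    unfolding primal_point_def T_def[symmetric] n_def[symmetric] W_def[symmetric] .
qed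

end
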